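(* Let $X=\mathbb R^m$ (with the Euclidean norm), let $f:X\to\mathbb R$ be locally Lipschitz, let $x\in X$, and let $r>0$. Then $$\eth f(x)\subset\partial_C f(x)\subset\partial_G^{r}f(x).$$ Consequently, $0\in\eth f(x)$ implies $0\in\partial_G^{r}f(x)$ for every $r>0$. The converse fails even in one dimension: there are a locally Lipschitz $f:\mathbb R\to\mathbb R$ and a point $x\in\mathbb R$ such that $0\in\partial_G^{r}f(x)$ for every $r>0$ but $0\notin\eth f(x)$.
   Context: $\langle x,x^*\rangle:=x^*(x)$, and $\overline B(x_0;r)$ is the closed norm ball. Core subdifferential (for the norm metric): for $f:X\to\mathbb R$ and $x_0\in X$, $x_0^*\in X^*$ belongs to $\eth f(x_0)$ if there is a family $(\delta_\varepsilon)_{\varepsilon>0}\subset(0,+\infty)$ with $\limsup_{\varepsilon\downarrow0}\delta_\varepsilon/\varepsilon=+\infty$ such that $f(x_0)+\langle x-x_0,x_0^*\rangle\le f(x)+\varepsilon$ for every $\varepsilon>0$ and every $x\in\overline B(x_0;\delta_\varepsilon)$. $\partial_C f$ is the Clarke subdifferential: for locally Lipschitz $f$, $\partial_C f(x)=\{x^*\mid\langle v,x^*\rangle\le f^\circ(x;v)\ \forall v\}$ with $f^\circ(x;v)=\limsup_{y\to x,\,t\downarrow0}\frac{f(y+tv)-f(y)}{t}$. Goldstein's $r$-subdifferential is $\partial_G^{r}f(x):=\operatorname{cl}\operatorname{co}\bigcup_{\|y-x\|\le r}\partial_C f(y)$, the closed convex hull of the union. *)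

theory Defs
  imports "HOL-Analysis.Analysis"
begin

text \<open>
  The dual space of \<open>'a\<close> is the type \<open>'a \<Rightarrow>\<^sub>L real\<close> of bounded linear functionals with the operator
  norm; the pairing of \<open>v\<close> with \<open>p\<close> is \<open>blinfun_apply p v\<close>.
\<close>

definition locally_lipschitz :: "('a::real_normed_vector \<Rightarrow> real) \<Rightarrow> bool" where
  "locally_lipschitz f \<longleftrightarrow> (\<forall>x. \<exists>u>0. \<exists>L. L-lipschitz_on (cball x u) f)"

text \<open>
  The family \<open>\<delta>\<close> is a total function on the reals; its values at nonpositive arguments play no
  role. The upper limit is taken in the extended reals, so that it may be infinite.
\<close>

definition core_subdifferential ::
    "('a::real_normed_vector \<Rightarrow> real) \<Rightarrow> 'a \<Rightarrow> ('a \<Rightarrow>\<^sub>L real) set" where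
  "core_subdifferential f x0 =
    {p. \<exists>\<delta> :: real \<Rightarrow> real.
          (\<forall>\<epsilon>>0. \<delta> \<epsilon> > 0) \<and>
          Limsup (at_right 0) (\<lambda>\<epsilon>. ereal (\<delta> \<epsilon> / \<epsilon>)) = \<infinity> \<and>
          (\<forall>\<epsilon>>0. \<forall>x\<in>cball x0 (\<delta> \<epsilon>). f x0 + blinfun_apply p (x - x0) \<le> f x + \<epsilon>)}"

text \<open>
  The upper limit over \<open>y \<rightarrow> x\<close>, \<open>t \<down> 0\<close> is joint, and \<open>y = x\<close> is allowed (hence \<open>nhds x\<close>, not
  \<open>at x\<close>). It is taken in the extended reals; it is finite if \<open>f\<close> is locally Lipschitz.
\<close>

definition clarke_derivative ::
    "('a::real_normed_vector \<Rightarrow> real) \<Rightarrow> 'a \<Rightarrow> 'a \<Rightarrow> ereal" where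
  "clarke_derivative f x v =
    Limsup (nhds x \<times>\<^sub>F at_right 0) (\<lambda>(y, t). ereal ((f (y + t *\<^sub>R v) - f y) / t))"

definition clarke_subdifferential ::
    "('a::real_normed_vector \<Rightarrow> real) \<Rightarrow> 'a \<Rightarrow> ('a \<Rightarrow>\<^sub>L real) set" where
  "clarke_subdifferential f x = {p. \<forall>v. ereal (blinfun_apply p v) \<le> clarke_derivative f x v}"

definition goldstein_subdifferential ::
    "real \<Rightarrow> ('a::real_normed_vector \<Rightarrow> real) \<Rightarrow> 'a \<Rightarrow> ('a \<Rightarrow>\<^sub>L real) set" where
  "goldstein_subdifferential r f x =
    closure (convex hull (\<Union>y\<in>{y. norm (y - x) \<le> r}. clarke_subdifferential f y))"

end

theory Submission
  imports Defs
begin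

text \<open>
  The first inclusion rests on a comparison of rates. If \<open>p\<close> lies outside \<open>\<partial>\<^sub>C f(x)\<close>, then in some
  direction \<open>v\<close> even the radial difference quotients at \<open>x\<close> stay a fixed amount \<open>k > 0\<close> below
  \<open>p(v)\<close>, since the Clarke derivative dominates the upper limit of these quotients
  (\<open>Limsup_along_le_clarke_derivative\<close> with the constant curve). Hence \<open>f - p\<close> decreases at least
  linearly along the ray, by more than \<open>k t\<close> at every small time \<open>t\<close>. Membership in the core subdifferential
  allows a decrease of at most \<open>\<epsilon>\<close> up to distance \<open>\<delta>\<^sub>\<epsilon>\<close>, which forces \<open>\<delta>\<^sub>\<epsilon> = O(\<epsilon>)\<close> as \<open>\<epsilon> \<down> 0\<close> and contradicts
  \<open>limsup \<delta>\<^sub>\<epsilon> / \<epsilon> = \<infinity>\<close>. The second inclusion holds because the union that defines the Goldstein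
  subdifferential contains \<open>\<partial>\<^sub>C f(x)\<close>.

  The converse fails for \<open>f(x) = -\<bar>x\<bar>\<close> at \<open>0\<close>. The Clarke derivative is taken over moving base
  points, so it sees the ascent of \<open>f\<close> towards its peak, and \<open>0 \<in> \<partial>\<^sub>C f(0)\<close>. The linear decrease
  away from the peak gives \<open>\<delta>\<^sub>\<epsilon> \<le> \<epsilon>\<close>, so \<open>0\<close> is not in the core subdifferential.
\<close>

text \<open>
  A curve of base points converging to \<open>x\<close> samples the joint upper limit, which therefore dominates
  the upper limit along the curve. Constant curves give the upper Dini derivative at \<open>x\<close>; other
  curves bring in the behaviour of \<open>f\<close> near \<open>x\<close>.
\<close>

lemma Limsup_along_le_clarke_derivative:
  fixes f :: "'a::real_normed_vector \<Rightarrow> real"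
  assumes "(\<gamma> \<longlongrightarrow> x) (at_right 0)"
  shows "Limsup (at_right 0) (\<lambda>t. ereal ((f (\<gamma> t + t *\<^sub>R v) - f (\<gamma> t)) / t))
           \<le> clarke_derivative f x v"
proof -
  have lim: "filterlim (\<lambda>t. (\<gamma> t, t)) (nhds x \<times>\<^sub>F at_right 0) (at_right 0)"
    using assms by (intro filterlim_Pair filterlim_ident)
  show ?thesis
    unfolding clarke_derivative_def
  proof (rule Limsup_le_iff[THEN iffD2], intro allI impI)
    fix c
    assume "c > Limsup (nhds x \<times>\<^sub>F at_right 0)
                 (\<lambda>(y, t). ereal ((f (y + t *\<^sub>R v) - f y) / t))"
    then have "\<forall>\<^sub>F (y, t) in nhds x \<times>\<^sub>F at_right 0. ereal ((f (y + t *\<^sub>R v) - f y) / t) < c"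
      by (auto dest: Limsup_lessD simp: case_prod_unfold)
    from eventually_compose_filterlim[OF this lim]
    show "\<forall>\<^sub>F t in at_right 0. ereal ((f (\<gamma> t + t *\<^sub>R v) - f (\<gamma> t)) / t) < c"
      by simp
  qed
qed

theorem core_subdifferential_subset_clarke_subdifferential:
  fixes f :: "'a::real_normed_vector \<Rightarrow> real"
  shows "core_subdifferential f x \<subseteq> clarke_subdifferential f x"
proof
  fix p assume "p \<in> core_subdifferential f x"
  then obtain \<delta> :: "real \<Rightarrow> real" where
    \<delta>_pos: "\<And>\<epsilon>. \<epsilon> > 0 \<Longrightarrow> \<delta> \<epsilon> > 0" and
    \<delta>_limsup: "Limsup (at_right 0) (\<lambda>\<epsilon>. ereal (\<delta> \<epsilon> / \<epsilon>)) = \<infinity>" and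
    supp: "\<And>\<epsilon> y. \<epsilon> > 0 \<Longrightarrow> y \<in> cball x (\<delta> \<epsilon>) \<Longrightarrow> f x + blinfun_apply p (y - x) \<le> f y + \<epsilon>"
    unfolding core_subdifferential_def by blast
  have "ereal (blinfun_apply p v) \<le> clarke_derivative f x v" for v
  proof (rule ccontr)
    assume "\<not> ereal (blinfun_apply p v) \<le> clarke_derivative f x v"
    then have "clarke_derivative f x v < ereal (blinfun_apply p v)" by simp
    from ereal_dense2[OF this] obtain c
      where c: "clarke_derivative f x v < ereal c" "c < blinfun_apply p v" by auto
    define k where "k = blinfun_apply p v - c"
    have k: "k > 0" using c by (simp add: k_def)
    have "Limsup (at_right 0) (\<lambda>t. ereal ((f (x + t *\<^sub>R v) - f x) / t)) < ereal c"
      using Limsup_along_le_clarke_derivative[of "\<lambda>_. x" x f v] c(1) by simp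
    then have "\<forall>\<^sub>F t in at_right 0. (f (x + t *\<^sub>R v) - f x) / t < c"
      by (auto dest: Limsup_lessD)
    then obtain \<eta> where \<eta>: "\<eta> > 0"
      and quot: "\<And>t. 0 < t \<Longrightarrow> t < \<eta> \<Longrightarrow> (f (x + t *\<^sub>R v) - f x) / t < c"
      unfolding eventually_at_right_field by auto
    \<comment> \<open>Enlarging the norm by one also covers \<open>v = 0\<close>.\<close>
    define n where "n = norm v + 1"
    have n: "n > 0" by (simp add: n_def add_nonneg_pos)
    have "\<not> (\<forall>\<^sub>F \<epsilon> in at_right 0. \<delta> \<epsilon> / \<epsilon> \<le> n / k)"
    proof
      assume "\<forall>\<^sub>F \<epsilon> in at_right 0. \<delta> \<epsilon> / \<epsilon> \<le> n / k"
      then have "Limsup (at_right 0) (\<lambda>\<epsilon>. ereal (\<delta> \<epsilon> / \<epsilon>)) \<le> ereal (n / k)"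
        by (intro Limsup_bounded) simp
      with \<delta>_limsup show False by simp
    qed
    moreover have "\<forall>\<^sub>F \<epsilon> in at_right 0. \<delta> \<epsilon> / \<epsilon> \<le> n / k"
      unfolding eventually_at_right_field
    proof (intro exI[of _ "k * \<eta> / 2"] conjI allI impI)
      show "0 < k * \<eta> / 2" using k \<eta> by simp
    next
      fix \<epsilon> :: real assume \<epsilon>: "0 < \<epsilon>" "\<epsilon> < k * \<eta> / 2"
      \<comment> \<open>The point at time \<open>t\<close> must lie in the ball of radius \<open>\<delta> \<epsilon>\<close>, which may be large,
        and in the range where the difference quotients are controlled.\<close>
      define t where "t = min (\<delta> \<epsilon> / n) (\<eta> / 2)"
      have t: "0 < t" "t < \<eta>" "t \<le> \<delta> \<epsilon> / n"
        using \<delta>_pos[OF \<epsilon>(1)] n \<eta> by (auto simp: t_def)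
      have "t * norm v \<le> t * n" using t by (simp add: n_def)
      also have "\<dots> \<le> \<delta> \<epsilon>" using t(3) n by (simp add: field_simps)
      finally have "x + t *\<^sub>R v \<in> cball x (\<delta> \<epsilon>)" using t(1) by (simp add: dist_norm)
      from supp[OF \<epsilon>(1) this] have "t * blinfun_apply p v \<le> f (x + t *\<^sub>R v) - f x + \<epsilon>"
        by (simp add: blinfun.scaleR_right)
      moreover have "f (x + t *\<^sub>R v) - f x < t * c"
        using quot[OF t(1,2)] t(1) by (simp add: field_simps)
      ultimately have tk: "k * t < \<epsilon>" by (simp add: k_def algebra_simps)
      \<comment> \<open>Since \<open>k * t < \<epsilon> < k * \<eta> / 2\<close>, the minimum in \<open>t\<close> is attained by the first term.\<close>
      have "t \<noteq> \<eta> / 2" using tk \<epsilon>(2) by auto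
      then have "t = \<delta> \<epsilon> / n" by (auto simp: t_def min_def split: if_splits)
      with tk n k \<epsilon>(1) show "\<delta> \<epsilon> / \<epsilon> \<le> n / k" by (simp add: field_simps)
    qed
    ultimately show False by blast
  qed
  then show "p \<in> clarke_subdifferential f x" by (simp add: clarke_subdifferential_def)
qed

lemma clarke_subdifferential_subset_goldstein_subdifferential:
  assumes "r \<ge> 0"
  shows "clarke_subdifferential f x \<subseteq> goldstein_subdifferential r f x"
proof -
  have "clarke_subdifferential f x \<subseteq> (\<Union>y\<in>{y. norm (y - x) \<le> r}. clarke_subdifferential f y)"
    using assms by (intro UN_upper) simp
  then show ?thesis
    unfolding goldstein_subdifferential_def
    by (rule subset_trans[OF _ subset_trans[OF hull_subset closure_subset]])
qed

lemma locally_lipschitz_minus_abs: "locally_lipschitz (\<lambda>x::real. - \<bar>x\<bar>)"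
  unfolding locally_lipschitz_def
proof
  fix x :: real
  have "1-lipschitz_on (cball x 1) (\<lambda>x::real. - \<bar>x\<bar>)"
    by (rule lipschitz_onI) (auto simp: dist_real_def)
  then show "\<exists>u>0. \<exists>L. L-lipschitz_on (cball x u) (\<lambda>x::real. - \<bar>x\<bar>)"
    by (intro exI[of _ 1]) auto
qed

text \<open>
  Based at \<open>-t v\<close>, a step of length \<open>t\<close> in direction \<open>v\<close> climbs to the peak at \<open>0\<close>, so its
  difference quotient is \<open>\<bar>v\<bar>\<close>.
\<close>

lemma zero_in_clarke_subdifferential_minus_abs:
  "0 \<in> clarke_subdifferential (\<lambda>x::real. - \<bar>x\<bar>) 0"
proof -
  have "0 \<le> clarke_derivative (\<lambda>x::real. - \<bar>x\<bar>) 0 v" for v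
  proof -
    have "((\<lambda>t. - (t * v)) \<longlongrightarrow> - (0 * v)) (at_right 0)" by (intro tendsto_intros)
    then have lim: "((\<lambda>t. - (t * v)) \<longlongrightarrow> 0) (at_right 0)" by simp
    have "0 \<le> ereal \<bar>v\<bar>" by simp
    also have "\<dots> = Limsup (at_right (0::real)) (\<lambda>_. ereal \<bar>v\<bar>)"
      by (simp add: Limsup_const)
    also have "\<dots> = Limsup (at_right 0)
        (\<lambda>t. ereal ((- \<bar>- (t * v) + t *\<^sub>R v\<bar> - (- \<bar>- (t * v)\<bar>)) / t))"
      by (intro Limsup_eq eventually_at_rightI[of 0 1]) (auto simp: abs_mult)
    also have "\<dots> \<le> clarke_derivative (\<lambda>x::real. - \<bar>x\<bar>) 0 v"
      by (rule Limsup_along_le_clarke_derivative[OF lim])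
    finally show ?thesis .
  qed
  then show ?thesis by (simp add: clarke_subdifferential_def zero_ereal_def)
qed

lemma zero_notin_core_subdifferential_minus_abs:
  "0 \<notin> core_subdifferential (\<lambda>x::real. - \<bar>x\<bar>) 0"
proof
  assume "0 \<in> core_subdifferential (\<lambda>x::real. - \<bar>x\<bar>) 0"
  then obtain \<delta> :: "real \<Rightarrow> real" where
    \<delta>_pos: "\<And>\<epsilon>. \<epsilon> > 0 \<Longrightarrow> \<delta> \<epsilon> > 0" and
    \<delta>_limsup: "Limsup (at_right 0) (\<lambda>\<epsilon>. ereal (\<delta> \<epsilon> / \<epsilon>)) = \<infinity>" and
    supp: "\<forall>\<epsilon>>0. \<forall>y\<in>cball 0 (\<delta> \<epsilon>). \<bar>y\<bar> \<le> \<epsilon>"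
    unfolding core_subdifferential_def by auto
  have "\<delta> \<epsilon> / \<epsilon> \<le> 1" if "\<epsilon> > 0" for \<epsilon>
    using supp[rule_format, OF that, of "\<delta> \<epsilon>"] \<delta>_pos[OF that] that by simp
  then have "Limsup (at_right 0) (\<lambda>\<epsilon>. ereal (\<delta> \<epsilon> / \<epsilon>)) \<le> 1"
    by (intro Limsup_bounded eventually_at_rightI[of 0 1]) auto
  with \<delta>_limsup show False by simp
qed

theorem proposition25:
  shows
    "(\<forall>(f :: real ^ 'm \<Rightarrow> real) x. locally_lipschitz f \<longrightarrow>
        (\<forall>r>0. core_subdifferential f x \<subseteq> clarke_subdifferential f x \<and>
               clarke_subdifferential f x \<subseteq> goldstein_subdifferential r f x) \<and>
        (0 \<in> core_subdifferential f x \<longrightarrow> (\<forall>r>0. 0 \<in> goldstein_subdifferential r f x))) \<and>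
     (\<exists>(f :: real \<Rightarrow> real) x. locally_lipschitz f \<and>
        (\<forall>r>0. 0 \<in> goldstein_subdifferential r f x) \<and> 0 \<notin> core_subdifferential f x)"
proof (rule conjI)
  have core: "core_subdifferential f x \<subseteq> clarke_subdifferential f x"
    for f :: "real ^ 'm \<Rightarrow> real" and x
    by (rule core_subdifferential_subset_clarke_subdifferential)
  have goldstein: "clarke_subdifferential f x \<subseteq> goldstein_subdifferential r f x"
    if "r > 0" for f :: "real ^ 'm \<Rightarrow> real" and x r
    using that by (intro clarke_subdifferential_subset_goldstein_subdifferential) simp
  show "\<forall>(f :: real ^ 'm \<Rightarrow> real) x. locally_lipschitz f \<longrightarrow>
        (\<forall>r>0. core_subdifferential f x \<subseteq> clarke_subdifferential f x \<and>
               clarke_subdifferential f x \<subseteq> goldstein_subdifferential r f x) \<and>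
        (0 \<in> core_subdifferential f x \<longrightarrow> (\<forall>r>0. 0 \<in> goldstein_subdifferential r f x))"
    using core goldstein by blast
  have "\<forall>r>0. 0 \<in> goldstein_subdifferential r (\<lambda>x::real. - \<bar>x\<bar>) 0"
    using clarke_subdifferential_subset_goldstein_subdifferential
      zero_in_clarke_subdifferential_minus_abs less_imp_le by blast
  then show "\<exists>(f :: real \<Rightarrow> real) x. locally_lipschitz f \<and>
        (\<forall>r>0. 0 \<in> goldstein_subdifferential r f x) \<and> 0 \<notin> core_subdifferential f x"
    using locally_lipschitz_minus_abs zero_notin_core_subdifferential_minus_abs by blast
qed

end
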